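(* Let $(I,\cdot)$ be a super Cartan datum and let ${}'\mathbf f$ be the free $\mathbb Q(q)^\pi$-superalgebra on $\theta_i$ $(i\in I)$ with the homomorphism $r:{}'\mathbf f\to{}'\mathbf f\otimes{}'\mathbf f$ described in the context. There exists a unique $\mathbb Q(q)^\pi$-bilinear form $(\cdot,\cdot)$ on ${}'\mathbf f$ with values in $\mathbb Q(q)^\pi$ such that $(1,1)=1$ and (a) $(\theta_i,\theta_j)=\delta_{ij}(1-\pi_iq_i^{-2})^{-1}$ for all $i,j\in I$; (b) $(x,y'y'')=(r(x),y'\otimes y'')$ for all $x,y',y''\in{}'\mathbf f$; (c) $(xx',y'')=(x\otimes x',r(y''))$ for all $x,x',y''\in{}'\mathbf f$. Here the form on ${}'\mathbf f\otimes{}'\mathbf f$ is $(x_1\otimes x_2,x_1'\otimes x_2')=(x_1,x_1')(x_2,x_2')$. Moreover, this bilinear form is symmetric.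
   Context: A super Cartan datum is a finite set $I=I_{\bar 0}\sqcup I_{\bar 1}$ with $I_{\bar 1}\ne\emptyset$ and a symmetric $\mathbb Z$-valued bilinear form $\nu,\nu'\mapsto \nu\cdot\nu'$ on $\mathbb Z[I]$ such that $d_i=\frac{i\cdot i}{2}\in\mathbb Z_{>0}$; $2\frac{i\cdot j}{i\cdot i}\in-\mathbb N$ for $i\ne j$ ($\mathbb N=\{0,1,2,\dots\}$); and $2\frac{i\cdot j}{i\cdot i}\in 2\mathbb Z$ for $i\in I_{\bar 1}$, $j\in I$. The parity $p:\mathbb Z[I]\to\mathbb Z$ is the homomorphism with $p(i)=0$ for $i\in I_{\bar 0}$ and $p(i)=1$ for $i\in I_{\bar 1}$. $\mathbb Q(q)^\pi=\mathbb Q(q)[\pi]/(\pi^2-1)$; $q_i=q^{d_i}$, $\pi_i=\pi^{p(i)}$. ${}'\mathbf f$ is the free associative unital $\mathbb Q(q)^\pi$-superalgebra on generators $\theta_i$ $(i\in I)$, with $\mathbb N[I]$-grading $|\theta_i|=i$ and parity $p(\theta_i)=p(i)$. The tensor product ${}'\mathbf f\otimes{}'\mathbf f$ (over $\mathbb Q(q)^\pi$) has multiplication, on homogeneous elements, $(x_1\otimes x_2)(x_1'\otimes x_2')=q^{|x_2|\cdot|x_1'|}\pi^{p(x_2)p(x_1')}x_1x_1'\otimes x_2x_2'$. The map $r:{}'\mathbf f\to{}'\mathbf f\otimes{}'\mathbf f$ is the algebra homomorphism with $r(\theta_i)=\theta_i\otimes1+1\otimes\theta_i$. *)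

theory Defs
  imports
    "HOL-Library.Poly_Mapping"
    "HOL-Computational_Algebra.Polynomial"
    "HOL-Computational_Algebra.Fraction_Field"
begin

section \<open>The ground ring \<open>\<rat>(q)\<^sup>\<pi> = \<rat>(q)[\<pi>]/(\<pi>\<^sup>2 - 1)\<close>\<close>

quotient_type qpi = "rat poly fract poly" / "\<lambda>f g. [:-1, 0, 1:] dvd f - g"
proof (intro equivpI reflpI sympI transpI)
  fix f g h :: "rat poly fract poly"
  show "[:-1, 0, 1:] dvd f - f" by simp
  show "[:-1, 0, 1:] dvd g - f" if "[:-1, 0, 1:] dvd f - g"
    using that by (metis dvd_minus_iff minus_diff_eq)
  show "[:-1, 0, 1:] dvd f - h" if "[:-1, 0, 1:] dvd f - g" "[:-1, 0, 1:] dvd g - h"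
    using dvd_add[OF that] by simp
qed

instantiation qpi :: comm_ring_1
begin

lift_definition zero_qpi :: qpi is 0 .
lift_definition one_qpi :: qpi is 1 .
lift_definition plus_qpi :: "qpi \<Rightarrow> qpi \<Rightarrow> qpi" is "(+)"
  subgoal for f f' g g' using dvd_add[of _ "f - f'" "g - g'"] by (simp add: algebra_simps)
  done
lift_definition uminus_qpi :: "qpi \<Rightarrow> qpi" is uminus
  subgoal for f f' by (metis dvd_minus_iff minus_diff_minus)
  done
lift_definition minus_qpi :: "qpi \<Rightarrow> qpi \<Rightarrow> qpi" is "(-)"
  subgoal for f f' g g' using dvd_diff[of _ "f - f'" "g - g'"] by (simp add: algebra_simps)
  done
lift_definition times_qpi :: "qpi \<Rightarrow> qpi \<Rightarrow> qpi" is "(*)"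
proof -
  fix f f' g g' :: "rat poly fract poly"
  assume "[:-1, 0, 1:] dvd f - f'" "[:-1, 0, 1:] dvd g - g'"
  hence "[:-1, 0, 1:] dvd (f - f') * g + f' * (g - g')" by (intro dvd_add dvd_mult dvd_mult2)
  thus "[:-1, 0, 1:] dvd f * g - f' * g'" by (simp add: algebra_simps)
qed

instance
proof
  fix a b c :: qpi
  show "a * b * c = a * (b * c)" by transfer (simp add: mult.assoc)
  show "a * b = b * a" by transfer (simp add: mult.commute)
  show "1 * a = a" by transfer simp
  show "a + b + c = a + (b + c)" by transfer (simp add: add.assoc)
  show "a + b = b + a" by transfer (simp add: add.commute)
  show "0 + a = a" by transfer simp
  show "- a + a = 0" by transfer simp
  show "a - b = a + - b" by transfer simp
  show "(a + b) * c = a * c + b * c" by transfer (simp add: distrib_right)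
  show "(0::qpi) \<noteq> 1"
  proof transfer
    show "\<not> [:-1, 0, 1:] dvd (0 :: rat poly fract poly) - 1"
    proof
      assume "[:-1, 0, 1:] dvd (0 :: rat poly fract poly) - 1"
      hence "[:-1, 0, 1:] dvd (1 :: rat poly fract poly)" by simp
      hence "degree [:-1, 0, 1 :: rat poly fract:] \<le> degree (1 :: rat poly fract poly)"
        by (rule dvd_imp_degree_le) simp
      thus False by simp
    qed
  qed
qed

end

definition q :: "rat poly fract" where
  "q = Fract [:0, 1:] 1"

definition of_ratfun :: "rat poly fract \<Rightarrow> qpi" where
  "of_ratfun c = abs_qpi [:c:]"

definition pi_elt :: qpi where
  "pi_elt = abs_qpi [:0, 1:]"

lemma pi_elt_square: "pi_elt * pi_elt = 1"
  by (simp add: pi_elt_def times_qpi.abs_eq one_qpi_def qpi.abs_eq_iff one_pCons)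

lemma of_ratfun_hom:
  "of_ratfun 0 = 0" "of_ratfun 1 = 1"
  "of_ratfun (a + b) = of_ratfun a + of_ratfun b"
  "of_ratfun (a * b) = of_ratfun a * of_ratfun b"
  by (simp_all add: of_ratfun_def zero_qpi_def one_qpi_def plus_qpi.abs_eq times_qpi.abs_eq
      one_pCons mult.commute)

lemma of_ratfun_inverse: "a \<noteq> 0 \<Longrightarrow> of_ratfun (inverse a) * of_ratfun a = 1"
  by (simp flip: of_ratfun_hom(2,4))

text \<open>The inverse of a unit in a commutative ring; arbitrary on non-units.\<close>

definition unit_inv :: "'a::comm_ring_1 \<Rightarrow> 'a" where
  "unit_inv x = (THE y. x * y = 1)"

lemma unit_inv_eq:
  assumes "x * y = (1 :: 'a::comm_ring_1)"
  shows "unit_inv x = y"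
  unfolding unit_inv_def
proof (rule the_equality)
  fix z assume "x * z = 1"
  thus "z = y" using assms by (metis mult.assoc mult.commute mult.right_neutral)
qed (fact assms)


section \<open>Super Cartan data\<close>

text \<open>The index set \<open>I\<close> is a finite type \<open>'i\<close>, the lattice \<open>\<int>[I]\<close> is the library's free abelian group
  \<^typ>\<open>'i \<Rightarrow>\<^sub>0 int\<close>,
  with \<^term>\<open>frag_of i\<close> the basis element of \<open>i\<close>, and \<open>I\<^sub>1\<close> is the set of odd indices.\<close>

type_synonym 'i root_lattice = "'i \<Rightarrow>\<^sub>0 int"

locale super_cartan_datum =
  fixes I\<^sub>1 :: "'i::finite set"
    and dot :: "'i root_lattice \<Rightarrow> 'i root_lattice \<Rightarrow> int"
  assumes odd_nonempty: "I\<^sub>1 \<noteq> {}"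
    and dot_add_left: "dot (\<mu> + \<nu>) \<rho> = dot \<mu> \<rho> + dot \<nu> \<rho>"
    and dot_sym: "dot \<mu> \<nu> = dot \<nu> \<mu>"
    and dot_self: "even (dot (frag_of i) (frag_of i))" "dot (frag_of i) (frag_of i) div 2 > 0"
    and dot_offdiag: "i \<noteq> j \<Longrightarrow>
      - (2 * of_int (dot (frag_of i) (frag_of j)) / of_int (dot (frag_of i) (frag_of i)) :: rat) \<in> \<nat>"
    and dot_odd: "i \<in> I\<^sub>1 \<Longrightarrow>
      \<exists>m::int. (2 * of_int (dot (frag_of i) (frag_of j)) / of_int (dot (frag_of i) (frag_of i)) :: rat)
        = of_int (2 * m)"

definition parity :: "'i::finite set \<Rightarrow> 'i root_lattice \<Rightarrow> int" where
  "parity I\<^sub>1 \<nu> = (\<Sum>i\<in>I\<^sub>1. Poly_Mapping.lookup \<nu> i)"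

lemma parity_add: "parity I\<^sub>1 (\<mu> + \<nu>) = parity I\<^sub>1 \<mu> + parity I\<^sub>1 \<nu>"
  by (simp add: parity_def lookup_add sum.distrib)

lemma parity_frag_of: "parity I\<^sub>1 (frag_of i) = (if i \<in> I\<^sub>1 then 1 else 0)"
  by (simp add: parity_def lookup_single when_def)

definition half_norm :: "('i root_lattice \<Rightarrow> 'i root_lattice \<Rightarrow> int) \<Rightarrow> 'i \<Rightarrow> int" where
  "half_norm dot i = dot (frag_of i) (frag_of i) div 2"

definition q_idx :: "('i root_lattice \<Rightarrow> 'i root_lattice \<Rightarrow> int) \<Rightarrow> 'i \<Rightarrow> rat poly fract" where
  "q_idx dot i = q powi half_norm dot i"

definition pi_idx :: "'i::finite set \<Rightarrow> 'i \<Rightarrow> qpi" where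
  "pi_idx I\<^sub>1 i = pi_elt ^ nat (parity I\<^sub>1 (frag_of i))"

lemma q_nonzero: "q \<noteq> 0"
  by (simp add: q_def Zero_fract_def eq_fract)

lemma q_power: "q ^ n = Fract ([:0, 1:] ^ n) 1"
  by (induction n) (simp_all add: q_def One_fract_def)

lemma q_power_neq_1: "n > 0 \<Longrightarrow> q ^ n \<noteq> 1"
proof
  assume n: "n > 0" and "q ^ n = 1"
  hence "[:0, 1:] ^ n = (1 :: rat poly)"
    by (simp add: q_power One_fract_def eq_fract)
  hence "degree ([:0, 1 :: rat:] ^ n) = 0" by simp
  thus False using n by (simp add: degree_power_eq)
qed

lemma (in super_cartan_datum) norm_constant_unit:
  "(1 - pi_idx I\<^sub>1 i * of_ratfun (q_idx dot i powi (-2))) *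
     unit_inv (1 - pi_idx I\<^sub>1 i * of_ratfun (q_idx dot i powi (-2))) = 1"
proof -
  define a where "a = q_idx dot i powi (-2)"
  define p where "p = pi_idx I\<^sub>1 i"
  have pp: "p * p = 1"
    by (simp add: p_def pi_idx_def parity_frag_of pi_elt_square)
  have d: "half_norm dot i > 0"
    using dot_self(2)[of i] by (simp add: half_norm_def)
  define m where "m = nat (half_norm dot i * 4)"
  have "a * a = q powi (- int m)"
    unfolding a_def q_idx_def m_def
    using d by (simp add: q_nonzero mult.commute flip: power_int_mult power_int_add)
  also have "\<dots> = inverse (q ^ m)" by (simp add: power_int_minus)
  finally have "a * a \<noteq> 1"
    using q_power_neq_1[of m] d by (simp add: m_def)
  hence nz: "1 - a * a \<noteq> 0" by simp
  have "(1 - p * of_ratfun a) * (1 + p * of_ratfun a) = 1 - (p * p) * of_ratfun (a * a)"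
    by (simp add: algebra_simps of_ratfun_hom)
  also have "\<dots> = of_ratfun (1 - a * a)"
    using of_ratfun_hom(3)[of "1 - a * a" "a * a"] by (simp add: pp of_ratfun_hom(2) algebra_simps)
  finally have "(1 - p * of_ratfun a) * ((1 + p * of_ratfun a) * of_ratfun (inverse (1 - a * a))) = 1"
    using of_ratfun_inverse[OF nz] by (simp add: mult.assoc[symmetric] mult.commute)
  from unit_inv_eq[OF this] this show ?thesis
    by (simp add: a_def p_def)
qed


section \<open>Free modules, linear extension, bilinear maps\<close>

text \<open>\<^typ>\<open>'a \<Rightarrow>\<^sub>0 qpi\<close> is the free module on the basis \<open>'a\<close>.\<close>

definition scale :: "qpi \<Rightarrow> ('a \<Rightarrow>\<^sub>0 qpi) \<Rightarrow> ('a \<Rightarrow>\<^sub>0 qpi)" where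
  "scale c = Poly_Mapping.map ((*) c)"

definition lin_ext :: "(qpi \<Rightarrow> 'm::ab_group_add \<Rightarrow> 'm) \<Rightarrow> ('a \<Rightarrow> 'm) \<Rightarrow> ('a \<Rightarrow>\<^sub>0 qpi) \<Rightarrow> 'm" where
  "lin_ext s f x = (\<Sum>a\<in>Poly_Mapping.keys x. s (Poly_Mapping.lookup x a) (f a))"

definition bilinear_over ::
  "(qpi \<Rightarrow> 'a::ab_group_add \<Rightarrow> 'a) \<Rightarrow> (qpi \<Rightarrow> 'b::ab_group_add \<Rightarrow> 'b) \<Rightarrow>
   (qpi \<Rightarrow> 'c::ab_group_add \<Rightarrow> 'c) \<Rightarrow> ('a \<Rightarrow> 'b \<Rightarrow> 'c) \<Rightarrow> bool" where
  "bilinear_over s1 s2 s3 \<beta> \<longleftrightarrow>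
     (\<forall>y. module_hom s1 s3 (\<lambda>x. \<beta> x y)) \<and> (\<forall>x. module_hom s2 s3 (\<lambda>y. \<beta> x y))"

lemma lookup_scale: "Poly_Mapping.lookup (scale c x) a = c * Poly_Mapping.lookup x a"
  by (simp add: scale_def Poly_Mapping.map.rep_eq when_def)

lemma scale_single: "scale c (Poly_Mapping.single a b) = Poly_Mapping.single a (c * b)"
  by (rule poly_mapping_eqI) (simp add: lookup_scale lookup_single when_def)

lemma module_scale: "module scale"
  by standard (rule poly_mapping_eqI; simp add: lookup_scale lookup_add algebra_simps)+

lemma module_mult: "module ((*) :: qpi \<Rightarrow> qpi \<Rightarrow> qpi)"
  by standard (simp_all add: algebra_simps)

lemma lin_ext_superset:
  assumes "module s" "finite A" "Poly_Mapping.keys x \<subseteq> A"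
  shows "lin_ext s f x = (\<Sum>a\<in>A. s (Poly_Mapping.lookup x a) (f a))"
  unfolding lin_ext_def
  by (rule sum.mono_neutral_left)
     (use assms in \<open>auto simp: in_keys_iff module.scale_zero_left\<close>)

lemma lin_ext_linear:
  assumes s: "module s"
  shows "module_hom scale s (lin_ext s f)"
proof -
  interpret s: module s by fact
  interpret c: module "scale :: qpi \<Rightarrow> ('b \<Rightarrow>\<^sub>0 qpi) \<Rightarrow> _" by (rule module_scale)
  show ?thesis
  proof unfold_locales
    fix x y :: "'b \<Rightarrow>\<^sub>0 qpi"
    let ?A = "Poly_Mapping.keys x \<union> Poly_Mapping.keys y"
    have "Poly_Mapping.keys (x + y) \<subseteq> ?A" by (rule Poly_Mapping.keys_add)
    thus "lin_ext s f (x + y) = lin_ext s f x + lin_ext s f y"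
      by (simp add: lin_ext_superset[OF s, of ?A] lookup_add s.scale_left_distrib sum.distrib)
  next
    fix c and x :: "'b \<Rightarrow>\<^sub>0 qpi"
    have "Poly_Mapping.keys (scale c x) \<subseteq> Poly_Mapping.keys x"
      by (auto simp: in_keys_iff lookup_scale)
    thus "lin_ext s f (scale c x) = s c (lin_ext s f x)"
      by (simp add: lin_ext_superset[OF s, of "Poly_Mapping.keys x"] lookup_scale s.scale_sum_right)
  qed
qed

lemma lin_ext_single:
  assumes "module s"
  shows "lin_ext s f (Poly_Mapping.single a c) = s c (f a)"
  using lin_ext_superset[OF assms, of "{a}" "Poly_Mapping.single a c" f] by simp

lemma lin_ext_unique:
  assumes g: "module_hom scale s g" and "\<And>a. g (Poly_Mapping.single a 1) = f a"
  shows "g x = lin_ext s f x"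
proof -
  interpret g: module_hom scale s g by fact
  have "x = (\<Sum>a\<in>Poly_Mapping.keys x. scale (Poly_Mapping.lookup x a) (Poly_Mapping.single a 1))"
    by (rule poly_mapping_eqI)
       (simp add: lookup_sum scale_single lookup_single when_def sum.delta in_keys_iff)
  hence "g x = g (\<Sum>a\<in>Poly_Mapping.keys x. scale (Poly_Mapping.lookup x a) (Poly_Mapping.single a 1))"
    by simp
  also have "\<dots> = lin_ext s f x"
    unfolding lin_ext_def by (simp add: g.sum g.scale assms(2))
  finally show ?thesis .
qed

lemma linear_eqI_on:
  assumes "module_hom scale s g" "module_hom scale s h"
    and "\<And>a. a \<in> Poly_Mapping.keys x \<Longrightarrow> g (Poly_Mapping.single a 1) = h (Poly_Mapping.single a 1)"
  shows "g x = h x"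
  using lin_ext_unique[OF assms(1) refl, of x] lin_ext_unique[OF assms(2) refl, of x] assms(3)
  by (simp add: lin_ext_def)

lemma linear_eqI:
  assumes "module_hom scale s g" "module_hom scale s h"
    and "\<And>a. g (Poly_Mapping.single a 1) = h (Poly_Mapping.single a 1)"
  shows "g x = h x"
  using assms by (rule linear_eqI_on)

lemma lin_ext_linear_param:
  assumes s: "module s" and r: "module s'" and "\<And>a. module_hom s' s (\<lambda>y. f y a)"
  shows "module_hom s' s (\<lambda>y. lin_ext s (f y) x)"
proof -
  interpret s: module s by fact
  interpret r: module s' by fact
  show ?thesis
    by unfold_locales
       (simp_all add: lin_ext_def module_hom.add[OF assms(3)] module_hom.scale[OF assms(3)]
          s.scale_right_distrib sum.distrib s.scale_sum_right mult.commute)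
qed

lemma bilinear_lin_ext:
  assumes "module s"
  shows "bilinear_over scale scale s (\<lambda>u v. lin_ext s (\<lambda>a. lin_ext s (f a) v) u)"
  unfolding bilinear_over_def
  by (auto intro!: lin_ext_linear lin_ext_linear_param assms module_scale)

lemma bilinear_overD:
  assumes "bilinear_over s1 s2 s3 \<beta>"
  shows "module_hom s1 s3 (\<lambda>x. \<beta> x y)" "module_hom s2 s3 (\<lambda>y. \<beta> x y)"
  using assms by (auto simp: bilinear_over_def)

lemma module_hom_comp:
  assumes "module_hom s1 s2 f" "module_hom s2 s3 g"
  shows "module_hom s1 s3 (\<lambda>x. g (f x))"
  using module_hom_compose[OF assms] by (simp add: o_def)

lemma bilinear_eqI:
  assumes "bilinear_over scale scale s \<beta>" "bilinear_over scale scale s \<gamma>"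
    and "\<And>a b. \<beta> (Poly_Mapping.single a 1) (Poly_Mapping.single b 1) =
               \<gamma> (Poly_Mapping.single a 1) (Poly_Mapping.single b 1)"
  shows "\<beta> x y = \<gamma> x y"
proof (rule linear_eqI[of s "\<lambda>x. \<beta> x y" "\<lambda>x. \<gamma> x y"])
  fix a
  show "\<beta> (Poly_Mapping.single a 1) y = \<gamma> (Poly_Mapping.single a 1) y"
    by (rule linear_eqI[of s "\<beta> (Poly_Mapping.single a 1)" "\<gamma> (Poly_Mapping.single a 1)"])
       (use assms in \<open>auto dest: bilinear_overD\<close>)
qed (use assms in \<open>auto dest: bilinear_overD\<close>)


section \<open>The free superalgebra\<close>

text \<open>The free algebra is the monoid algebra of the free monoid of words in the letters \<open>I\<close>,
  with the convolution product of \<^theory>\<open>HOL-Library.Poly_Mapping\<close>.\<close>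

datatype 'i word = Word (letters: "'i list")

instantiation word :: (type) monoid_add
begin

definition zero_word :: "'a word" where
  "0 = Word []"
definition plus_word :: "'a word \<Rightarrow> 'a word \<Rightarrow> 'a word" where
  "v + w = Word (letters v @ letters w)"

instance
  by standard (simp_all add: zero_word_def plus_word_def)

end

type_synonym 'i free_alg = "'i word \<Rightarrow>\<^sub>0 qpi"

definition theta :: "'i \<Rightarrow> 'i free_alg" (\<open>\<theta>\<close>) where
  "\<theta> i = Poly_Mapping.single (Word [i]) 1"

lemma additive_eqI:
  assumes "additive g" "additive h"
    and "\<And>a b. g (Poly_Mapping.single a b) = h (Poly_Mapping.single a b)"
  shows "g x = h x"
proof -
  have "x = (\<Sum>a\<in>Poly_Mapping.keys x. Poly_Mapping.single a (Poly_Mapping.lookup x a))"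
    by (rule poly_mapping_eqI)
       (simp add: lookup_sum lookup_single when_def sum.delta in_keys_iff)
  hence "g x = g (\<Sum>a\<in>Poly_Mapping.keys x. Poly_Mapping.single a (Poly_Mapping.lookup x a))"
    and "h x = h (\<Sum>a\<in>Poly_Mapping.keys x. Poly_Mapping.single a (Poly_Mapping.lookup x a))"
    by simp_all
  thus ?thesis
    by (simp add: additive.sum[OF assms(1)] additive.sum[OF assms(2)] assms(3))
qed

lemma scale_conv_mult:
  fixes x :: "'i free_alg"
  shows "scale c x = Poly_Mapping.single 0 c * x" "scale c x = x * Poly_Mapping.single 0 c"
proof -
  interpret module "scale :: qpi \<Rightarrow> 'i free_alg \<Rightarrow> _" by (rule module_scale)
  show "scale c x = Poly_Mapping.single 0 c * x"
    by (rule additive_eqI)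
       (simp_all add: additive_def scale_single mult_single scale_right_distrib distrib_left)
  show "scale c x = x * Poly_Mapping.single 0 c"
    by (rule additive_eqI)
       (simp_all add: additive_def scale_single mult_single scale_right_distrib distrib_right mult.commute)
qed

lemma scale_mult:
  fixes x y :: "'i free_alg"
  shows "scale c x * y = scale c (x * y)" "x * scale c y = scale c (x * y)"
  by (simp only: scale_conv_mult(1) mult.assoc) (simp only: scale_conv_mult(2) mult.assoc)

lemma mult_bilinear: "bilinear_over scale scale scale ((*) :: 'i free_alg \<Rightarrow> _)"
  unfolding bilinear_over_def module_hom_iff
  by (auto simp: module_scale scale_mult distrib_left distrib_right)

definition weight :: "'i word \<Rightarrow> 'i root_lattice" where
  "weight w = (\<Sum>i\<leftarrow>letters w. frag_of i)"

definition homogeneous :: "'i free_alg \<Rightarrow> 'i root_lattice \<Rightarrow> bool" where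
  "homogeneous x \<nu> \<longleftrightarrow> (\<forall>w\<in>Poly_Mapping.keys x. weight w = \<nu>)"


section \<open>The twisted tensor square\<close>

text \<open>The tensor square of the free module on words is the free module on pairs of words;
  see \<open>tensor_universal\<close> below.\<close>

type_synonym 'i free_alg2 = "('i word \<times> 'i word) \<Rightarrow>\<^sub>0 qpi"

definition tensor :: "'i free_alg \<Rightarrow> 'i free_alg \<Rightarrow> 'i free_alg2" (infixr \<open>\<otimes>\<close> 72) where
  "x \<otimes> y = lin_ext scale (\<lambda>v. lin_ext scale (\<lambda>w. Poly_Mapping.single (v, w) 1) y) x"

text \<open>The scalar \<open>q\<^bsup>\<mu>\<cdot>\<nu>\<^esup> \<pi>\<^bsup>p(\<mu>)p(\<nu>)\<^esup>\<close>. It is only used for weights of words, where the exponent of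
  \<open>\<pi>\<close> is nonnegative, so that \<^const>\<open>nat\<close> does not truncate.\<close>

definition twist :: "'i::finite set \<Rightarrow> ('i root_lattice \<Rightarrow> 'i root_lattice \<Rightarrow> int) \<Rightarrow> 'i root_lattice \<Rightarrow> 'i root_lattice \<Rightarrow> qpi" where
  "twist I\<^sub>1 dot \<mu> \<nu> =
     of_ratfun (q powi dot \<mu> \<nu>) * pi_elt ^ nat (parity I\<^sub>1 \<mu> * parity I\<^sub>1 \<nu>)"

text \<open>The twisted product; \<open>tmult_homogeneous\<close> below gives its formula on homogeneous elements.\<close>

definition tmult :: "'i::finite set \<Rightarrow> ('i root_lattice \<Rightarrow> 'i root_lattice \<Rightarrow> int) \<Rightarrow>
    'i free_alg2 \<Rightarrow> 'i free_alg2 \<Rightarrow> 'i free_alg2" where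
  "tmult I\<^sub>1 dot s t =
     lin_ext scale (\<lambda>(v\<^sub>1, v\<^sub>2). lin_ext scale (\<lambda>(w\<^sub>1, w\<^sub>2).
       Poly_Mapping.single (v\<^sub>1 + w\<^sub>1, v\<^sub>2 + w\<^sub>2) (twist I\<^sub>1 dot (weight v\<^sub>2) (weight w\<^sub>1))) t) s"

lemma tensor_bilinear: "bilinear_over scale scale scale (\<otimes>)"
  unfolding tensor_def by (rule bilinear_lin_ext[OF module_scale])

lemma tensor_single:
  "Poly_Mapping.single v 1 \<otimes> Poly_Mapping.single w 1 = Poly_Mapping.single (v, w) 1"
  by (simp add: tensor_def lin_ext_single[OF module_scale] scale_single)

theorem tensor_universal:
  fixes \<beta> :: "'i free_alg \<Rightarrow> 'i free_alg \<Rightarrow> 'm::ab_group_add"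
  assumes s: "module s" and \<beta>: "bilinear_over scale scale s \<beta>"
  shows "\<exists>!L. module_hom scale s L \<and> (\<forall>x y. L (x \<otimes> y) = \<beta> x y)"
proof (rule ex_ex1I)
  define L where "L = lin_ext s (\<lambda>(v, w). \<beta> (Poly_Mapping.single v 1) (Poly_Mapping.single w 1))"
  have L: "module_hom scale s L"
    unfolding L_def by (rule lin_ext_linear[OF s])
  have "bilinear_over scale scale s (\<lambda>x y. L (x \<otimes> y))"
    unfolding bilinear_over_def
    by (intro conjI allI module_hom_comp[OF _ L] bilinear_overD[OF tensor_bilinear])
  from bilinear_eqI[OF this \<beta>] have "L (x \<otimes> y) = \<beta> x y" for x y
    by (simp add: tensor_single L_def lin_ext_single[OF s] module.scale_one[OF s])
  with L show "\<exists>L. module_hom scale s L \<and> (\<forall>x y. L (x \<otimes> y) = \<beta> x y)" by blast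
next
  fix L M
  assume "module_hom scale s L \<and> (\<forall>x y. L (x \<otimes> y) = \<beta> x y)"
    and "module_hom scale s M \<and> (\<forall>x y. M (x \<otimes> y) = \<beta> x y)"
  hence LM: "module_hom scale s L" "module_hom scale s M" "L (x \<otimes> y) = M (x \<otimes> y)" for x y
    by simp_all
  have "L (Poly_Mapping.single a 1) = M (Poly_Mapping.single a 1)" for a
    using LM(3)[of "Poly_Mapping.single (fst a) 1" "Poly_Mapping.single (snd a) 1"]
    by (simp add: tensor_single)
  thus "L = M"
    by (intro ext) (rule linear_eqI[OF LM(1,2)])
qed

lemma tmult_bilinear: "bilinear_over scale scale scale (tmult I\<^sub>1 dot)"
proof -
  have eq: "tmult I\<^sub>1 dot = (\<lambda>s t. lin_ext scale (\<lambda>v. lin_ext scale (\<lambda>w.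
      Poly_Mapping.single (fst v + fst w, snd v + snd w)
        (twist I\<^sub>1 dot (weight (snd v)) (weight (fst w)))) t) s)"
    by (intro ext) (simp only: tmult_def case_prod_beta')
  show ?thesis unfolding eq by (rule bilinear_lin_ext[OF module_scale])
qed

lemma tmult_single:
  "tmult I\<^sub>1 dot (Poly_Mapping.single (v\<^sub>1, v\<^sub>2) 1) (Poly_Mapping.single (w\<^sub>1, w\<^sub>2) 1) =
     scale (twist I\<^sub>1 dot (weight v\<^sub>2) (weight w\<^sub>1)) (Poly_Mapping.single (v\<^sub>1 + w\<^sub>1, v\<^sub>2 + w\<^sub>2) 1)"
  by (simp add: tmult_def lin_ext_single[OF module_scale] scale_single)

lemma linear_ident: "module_hom scale scale (\<lambda>x. x)"
  by (simp add: module_hom_iff module_scale)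

lemma linear_scale: "module_hom s scale f \<Longrightarrow> module_hom s scale (\<lambda>x. scale c (f x))"
  by (auto simp: module_hom_iff module_scale module.scale_right_distrib[OF module_scale]
        module.scale_scale[OF module_scale] mult.commute)

lemma linear_mult_qpi:
  assumes "module_hom s (*) (f :: _ \<Rightarrow> qpi)"
  shows "module_hom s (*) (\<lambda>x. f x * c)" "module_hom s (*) (\<lambda>x. c * f x)"
  using assms by (auto simp: module_hom_iff algebra_simps)

lemmas linear_intros = linear_ident linear_scale linear_mult_qpi
  module_hom_comp[OF _ bilinear_overD(1)[OF mult_bilinear]]
  module_hom_comp[OF _ bilinear_overD(2)[OF mult_bilinear]]
  module_hom_comp[OF _ bilinear_overD(1)[OF tensor_bilinear]]
  module_hom_comp[OF _ bilinear_overD(2)[OF tensor_bilinear]]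
  module_hom_comp[OF _ bilinear_overD(1)[OF tmult_bilinear]]
  module_hom_comp[OF _ bilinear_overD(2)[OF tmult_bilinear]]

theorem tmult_homogeneous:
  assumes "homogeneous x\<^sub>2 \<mu>" "homogeneous y\<^sub>1 \<nu>"
  shows "tmult I\<^sub>1 dot (x\<^sub>1 \<otimes> x\<^sub>2) (y\<^sub>1 \<otimes> y\<^sub>2) = scale (twist I\<^sub>1 dot \<mu> \<nu>) ((x\<^sub>1 * y\<^sub>1) \<otimes> (x\<^sub>2 * y\<^sub>2))"
proof (rule linear_eqI_on[of scale "\<lambda>x\<^sub>1. tmult I\<^sub>1 dot (x\<^sub>1 \<otimes> x\<^sub>2) (y\<^sub>1 \<otimes> y\<^sub>2)"
      "\<lambda>x\<^sub>1. scale (twist I\<^sub>1 dot \<mu> \<nu>) ((x\<^sub>1 * y\<^sub>1) \<otimes> (x\<^sub>2 * y\<^sub>2))"], goal_cases)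
  case (3 v\<^sub>1)
  let ?v\<^sub>1 = "Poly_Mapping.single v\<^sub>1 1 :: 'a free_alg"
  show ?case
  proof (rule linear_eqI_on[of scale "\<lambda>x\<^sub>2. tmult I\<^sub>1 dot (?v\<^sub>1 \<otimes> x\<^sub>2) (y\<^sub>1 \<otimes> y\<^sub>2)"
        "\<lambda>x\<^sub>2. scale (twist I\<^sub>1 dot \<mu> \<nu>) ((?v\<^sub>1 * y\<^sub>1) \<otimes> (x\<^sub>2 * y\<^sub>2))"], goal_cases)
    case (3 v\<^sub>2)
    let ?v\<^sub>2 = "Poly_Mapping.single v\<^sub>2 1 :: 'a free_alg"
    have v\<^sub>2: "weight v\<^sub>2 = \<mu>" using 3 assms(1) by (simp add: homogeneous_def)
    show ?case
    proof (rule linear_eqI_on[of scale "\<lambda>y\<^sub>1. tmult I\<^sub>1 dot (?v\<^sub>1 \<otimes> ?v\<^sub>2) (y\<^sub>1 \<otimes> y\<^sub>2)"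
          "\<lambda>y\<^sub>1. scale (twist I\<^sub>1 dot \<mu> \<nu>) ((?v\<^sub>1 * y\<^sub>1) \<otimes> (?v\<^sub>2 * y\<^sub>2))"], goal_cases)
      case (3 w\<^sub>1)
      let ?w\<^sub>1 = "Poly_Mapping.single w\<^sub>1 1 :: 'a free_alg"
      have w\<^sub>1: "weight w\<^sub>1 = \<nu>" using 3 assms(2) by (simp add: homogeneous_def)
      show ?case
        by (rule linear_eqI_on[of scale "\<lambda>y\<^sub>2. tmult I\<^sub>1 dot (?v\<^sub>1 \<otimes> ?v\<^sub>2) (?w\<^sub>1 \<otimes> y\<^sub>2)"
              "\<lambda>y\<^sub>2. scale (twist I\<^sub>1 dot \<mu> \<nu>) ((?v\<^sub>1 * ?w\<^sub>1) \<otimes> (?v\<^sub>2 * y\<^sub>2))"])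
           (auto intro!: linear_intros simp: tensor_single tmult_single mult_single v\<^sub>2 w\<^sub>1)
    qed (auto intro!: linear_intros)
  qed (auto intro!: linear_intros)
qed (auto intro!: linear_intros)

lemma weight_add: "weight (v + w) = weight v + weight w"
  by (simp add: weight_def plus_word_def)

lemma weight_zero: "weight 0 = 0"
  by (simp add: weight_def zero_word_def)

lemma parity_weight_nonneg: "parity I\<^sub>1 (weight w) \<ge> 0"
proof -
  have "parity I\<^sub>1 (\<Sum>i\<leftarrow>is. frag_of i) \<ge> 0" for "is"
  proof (induction "is")
    case Nil
    show ?case by (simp add: parity_def)
  next
    case (Cons i "is")
    thus ?case by (simp add: parity_add parity_frag_of)
  qed
  thus ?thesis by (simp add: weight_def)
qed

context super_cartan_datum
begin

lemma dot_add_right: "dot \<rho> (\<mu> + \<nu>) = dot \<rho> \<mu> + dot \<rho> \<nu>"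
  by (metis dot_add_left dot_sym)

lemma dot_zero: "dot 0 \<nu> = 0" "dot \<nu> 0 = 0"
  using dot_add_left[of 0 0 \<nu>] dot_add_right[of \<nu> 0 0] by simp_all

lemma twist_zero: "twist I\<^sub>1 dot 0 \<nu> = 1" "twist I\<^sub>1 dot \<nu> 0 = 1"
  by (simp_all add: twist_def dot_zero parity_def of_ratfun_hom)

lemma twist_add_left:
  "twist I\<^sub>1 dot (weight v + weight w) (weight u) =
     twist I\<^sub>1 dot (weight v) (weight u) * twist I\<^sub>1 dot (weight w) (weight u)"
  by (simp add: twist_def dot_add_left power_int_add q_nonzero of_ratfun_hom parity_add distrib_right distrib_left
        nat_add_distrib parity_weight_nonneg power_add mult_ac)

lemma twist_add_right:
  "twist I\<^sub>1 dot (weight u) (weight v + weight w) =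
     twist I\<^sub>1 dot (weight u) (weight v) * twist I\<^sub>1 dot (weight u) (weight w)"
  by (simp add: twist_def dot_add_right power_int_add q_nonzero of_ratfun_hom parity_add distrib_left
        nat_add_distrib parity_weight_nonneg power_add mult_ac)

lemma tensor_one: "(1 :: 'i free_alg) \<otimes> 1 = Poly_Mapping.single (0, 0) 1"
  by (simp add: tensor_single flip: single_one)

lemma tmult_one: "tmult I\<^sub>1 dot (1 \<otimes> 1) t = t" "tmult I\<^sub>1 dot t (1 \<otimes> 1) = t"
proof -
  show "tmult I\<^sub>1 dot (1 \<otimes> 1) t = t"
    by (rule linear_eqI[of scale "\<lambda>t. tmult I\<^sub>1 dot (1 \<otimes> 1) t" "\<lambda>t. t"])
       (auto intro!: linear_intros simp: tensor_one tmult_single weight_zero twist_zero scale_single)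
  show "tmult I\<^sub>1 dot t (1 \<otimes> 1) = t"
    by (rule linear_eqI[of scale "\<lambda>t. tmult I\<^sub>1 dot t (1 \<otimes> 1)" "\<lambda>t. t"])
       (auto intro!: linear_intros simp: tensor_one tmult_single weight_zero twist_zero scale_single)
qed

lemma tmult_scale:
  "tmult I\<^sub>1 dot (scale c s) t = scale c (tmult I\<^sub>1 dot s t)"
  "tmult I\<^sub>1 dot s (scale c t) = scale c (tmult I\<^sub>1 dot s t)"
  using bilinear_overD[OF tmult_bilinear] by (metis module_hom.scale)+

theorem tmult_assoc: "tmult I\<^sub>1 dot (tmult I\<^sub>1 dot s t) u = tmult I\<^sub>1 dot s (tmult I\<^sub>1 dot t u)"
proof (rule linear_eqI[of scale "\<lambda>s. tmult I\<^sub>1 dot (tmult I\<^sub>1 dot s t) u"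
      "\<lambda>s. tmult I\<^sub>1 dot s (tmult I\<^sub>1 dot t u)"], goal_cases)
  case (3 a)
  let ?a = "Poly_Mapping.single a 1 :: 'i free_alg2"
  show ?case
  proof (rule linear_eqI[of scale "\<lambda>t. tmult I\<^sub>1 dot (tmult I\<^sub>1 dot ?a t) u"
        "\<lambda>t. tmult I\<^sub>1 dot ?a (tmult I\<^sub>1 dot t u)"], goal_cases)
    case (3 b)
    let ?b = "Poly_Mapping.single b 1 :: 'i free_alg2"
    show ?case
    proof (rule linear_eqI[of scale "\<lambda>u. tmult I\<^sub>1 dot (tmult I\<^sub>1 dot ?a ?b) u"
          "\<lambda>u. tmult I\<^sub>1 dot ?a (tmult I\<^sub>1 dot ?b u)"], goal_cases)
      case (3 c)
      show ?case
        by (cases a; cases b; cases c)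
           (simp add: tmult_single tmult_scale weight_add twist_add_left twist_add_right
              module.scale_scale[OF module_scale] mult_ac add.assoc)
    qed (auto intro!: linear_intros)
  qed (auto intro!: linear_intros)
qed (auto intro!: linear_intros)

end

fun coprod_letters :: "'i::finite set \<Rightarrow> ('i root_lattice \<Rightarrow> 'i root_lattice \<Rightarrow> int) \<Rightarrow> 'i list \<Rightarrow> 'i free_alg2" where
  "coprod_letters I\<^sub>1 dot [] = 1 \<otimes> 1"
| "coprod_letters I\<^sub>1 dot (i # is) =
     tmult I\<^sub>1 dot (\<theta> i \<otimes> 1 + 1 \<otimes> \<theta> i) (coprod_letters I\<^sub>1 dot is)"

text \<open>The homomorphism \<open>r\<close>; see \<open>coprod_characterization\<close> below.\<close>

definition coprod :: "'i::finite set \<Rightarrow> ('i root_lattice \<Rightarrow> 'i root_lattice \<Rightarrow> int) \<Rightarrow> 'i free_alg \<Rightarrow> 'i free_alg2" where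
  "coprod I\<^sub>1 dot x = lin_ext scale (\<lambda>w. coprod_letters I\<^sub>1 dot (letters w)) x"

definition algebra_hom :: "'i::finite set \<Rightarrow> ('i root_lattice \<Rightarrow> 'i root_lattice \<Rightarrow> int) \<Rightarrow>
    ('i free_alg \<Rightarrow> 'i free_alg2) \<Rightarrow> bool" where
  "algebra_hom I\<^sub>1 dot r \<longleftrightarrow> module_hom scale scale r \<and> r 1 = 1 \<otimes> 1 \<and>
     (\<forall>x y. r (x * y) = tmult I\<^sub>1 dot (r x) (r y))"

text \<open>The bilinear form on the tensor square induced by \<open>B\<close>; see \<open>tensor_form_tensor\<close> below.\<close>

definition tensor_form :: "('i free_alg \<Rightarrow> 'i free_alg \<Rightarrow> qpi) \<Rightarrow>
    'i free_alg2 \<Rightarrow> 'i free_alg2 \<Rightarrow> qpi" where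
  "tensor_form B s t =
     lin_ext (*) (\<lambda>(v\<^sub>1, v\<^sub>2). lin_ext (*) (\<lambda>(w\<^sub>1, w\<^sub>2).
       B (Poly_Mapping.single v\<^sub>1 1) (Poly_Mapping.single w\<^sub>1 1) *
       B (Poly_Mapping.single v\<^sub>2 1) (Poly_Mapping.single w\<^sub>2 1)) t) s"

context super_cartan_datum
begin

lemma coprod_letters_append:
  "coprod_letters I\<^sub>1 dot (is @ js) =
     tmult I\<^sub>1 dot (coprod_letters I\<^sub>1 dot is) (coprod_letters I\<^sub>1 dot js)"
  by (induction "is") (simp_all add: tmult_one tmult_assoc)

lemma coprod_linear: "module_hom scale scale (coprod I\<^sub>1 dot)"
  unfolding coprod_def by (rule lin_ext_linear[OF module_scale])

lemma coprod_single:
  "coprod I\<^sub>1 dot (Poly_Mapping.single w 1) = coprod_letters I\<^sub>1 dot (letters w)"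
  by (simp add: coprod_def lin_ext_single[OF module_scale] module.scale_one[OF module_scale])

lemma coprod_algebra_hom: "algebra_hom I\<^sub>1 dot (coprod I\<^sub>1 dot)"
proof -
  have 1: "bilinear_over scale scale scale (\<lambda>x y. coprod I\<^sub>1 dot (x * y))"
    by (auto simp: bilinear_over_def intro!: module_hom_comp[OF _ coprod_linear] linear_intros)
  have 2: "bilinear_over scale scale scale (\<lambda>x y. tmult I\<^sub>1 dot (coprod I\<^sub>1 dot x) (coprod I\<^sub>1 dot y))"
    by (auto simp: bilinear_over_def intro!: coprod_linear linear_intros)
  have "coprod I\<^sub>1 dot (x * y) = tmult I\<^sub>1 dot (coprod I\<^sub>1 dot x) (coprod I\<^sub>1 dot y)" for x y
    by (rule bilinear_eqI[OF 1 2])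
       (simp add: mult_single coprod_single coprod_letters_append plus_word_def)
  moreover have "coprod I\<^sub>1 dot 1 = 1 \<otimes> 1"
    using coprod_single[of 0] by (simp add: zero_word_def flip: single_one)
  ultimately show ?thesis
    by (simp add: algebra_hom_def coprod_linear)
qed

theorem coprod_characterization:
  "(algebra_hom I\<^sub>1 dot r \<and> (\<forall>i. r (\<theta> i) = \<theta> i \<otimes> 1 + 1 \<otimes> \<theta> i)) \<longleftrightarrow> r = coprod I\<^sub>1 dot"
proof (intro iffI conjI ext)
  fix x
  assume r: "algebra_hom I\<^sub>1 dot r \<and> (\<forall>i. r (\<theta> i) = \<theta> i \<otimes> 1 + 1 \<otimes> \<theta> i)"
  have "r (Poly_Mapping.single (Word is) 1) = coprod_letters I\<^sub>1 dot is" for "is"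
  proof (induction "is")
    case Nil
    have "Poly_Mapping.single (Word []) 1 = (1 :: 'i free_alg)" by (simp flip: zero_word_def)
    thus ?case using r by (simp add: algebra_hom_def)
  next
    case (Cons i "is")
    have "Poly_Mapping.single (Word (i # is)) 1 = \<theta> i * Poly_Mapping.single (Word is) 1"
      by (simp add: theta_def mult_single plus_word_def)
    thus ?case using r Cons by (simp add: algebra_hom_def)
  qed
  hence "r (Poly_Mapping.single w 1) = coprod I\<^sub>1 dot (Poly_Mapping.single w 1)" for w
    by (cases w) (simp add: coprod_single)
  thus "r x = coprod I\<^sub>1 dot x"
    using r by (subst linear_eqI[OF _ coprod_linear]) (auto simp: algebra_hom_def)
next
  assume r: "r = coprod I\<^sub>1 dot"
  show "algebra_hom I\<^sub>1 dot r" by (simp add: r coprod_algebra_hom)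
  show "\<forall>i. r (\<theta> i) = \<theta> i \<otimes> 1 + 1 \<otimes> \<theta> i"
    using coprod_single[of "Word [_]"] by (simp add: r theta_def tmult_one)
qed

end

lemma tensor_form_bilinear: "bilinear_over scale scale (*) (tensor_form B)"
proof -
  have eq: "tensor_form B = (\<lambda>s t. lin_ext (*) (\<lambda>v. lin_ext (*) (\<lambda>w.
      B (Poly_Mapping.single (fst v) 1) (Poly_Mapping.single (fst w) 1) *
      B (Poly_Mapping.single (snd v) 1) (Poly_Mapping.single (snd w) 1)) t) s)"
    by (intro ext) (simp only: tensor_form_def case_prod_beta')
  show ?thesis unfolding eq by (rule bilinear_lin_ext[OF module_mult])
qed

theorem tensor_form_tensor:
  assumes B: "bilinear_over scale scale (*) B"
  shows "tensor_form B (x\<^sub>1 \<otimes> x\<^sub>2) (y\<^sub>1 \<otimes> y\<^sub>2) = B x\<^sub>1 y\<^sub>1 * B x\<^sub>2 y\<^sub>2"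
proof -
  have B1: "module_hom scale (*) (\<lambda>x. B x y)" for y by (rule bilinear_overD(1)[OF B])
  have B2: "module_hom scale (*) (B x)" for x by (rule bilinear_overD(2)[OF B])
  note T1 = module_hom_comp[OF _ bilinear_overD(1)[OF tensor_form_bilinear]]
  note T2 = module_hom_comp[OF _ bilinear_overD(2)[OF tensor_form_bilinear]]
  note t1 = bilinear_overD(1)[OF tensor_bilinear] and t2 = bilinear_overD(2)[OF tensor_bilinear]
  have l1: "bilinear_over scale scale (*) (\<lambda>y\<^sub>1 y\<^sub>2. tensor_form B s (y\<^sub>1 \<otimes> y\<^sub>2))" for s
    unfolding bilinear_over_def by (intro conjI allI T2 t1 t2)
  have r1: "bilinear_over scale scale (*) (\<lambda>y\<^sub>1 y\<^sub>2. B x\<^sub>1 y\<^sub>1 * B x\<^sub>2 y\<^sub>2)" for x\<^sub>1 x\<^sub>2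
    unfolding bilinear_over_def by (intro conjI allI linear_mult_qpi B2)
  have l2: "bilinear_over scale scale (*) (\<lambda>x\<^sub>1 x\<^sub>2. tensor_form B (x\<^sub>1 \<otimes> x\<^sub>2) t)" for t
    unfolding bilinear_over_def by (intro conjI allI T1 t1 t2)
  have r2: "bilinear_over scale scale (*) (\<lambda>x\<^sub>1 x\<^sub>2. B x\<^sub>1 y\<^sub>1 * B x\<^sub>2 y\<^sub>2)" for y\<^sub>1 y\<^sub>2
    unfolding bilinear_over_def by (intro conjI allI linear_mult_qpi B1)
  have "tensor_form B (Poly_Mapping.single v\<^sub>1 1 \<otimes> Poly_Mapping.single v\<^sub>2 1) (y\<^sub>1 \<otimes> y\<^sub>2) =
      B (Poly_Mapping.single v\<^sub>1 1) y\<^sub>1 * B (Poly_Mapping.single v\<^sub>2 1) y\<^sub>2" for v\<^sub>1 v\<^sub>2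
    by (rule bilinear_eqI[OF l1 r1])
       (simp add: tensor_single tensor_form_def lin_ext_single[OF module_mult])
  thus ?thesis
    by (rule bilinear_eqI[OF l2 r2])
qed


section \<open>The characterising conditions of the form\<close>

definition adapted_form :: "'i::finite set \<Rightarrow> ('i root_lattice \<Rightarrow> 'i root_lattice \<Rightarrow> int) \<Rightarrow>
    ('i free_alg \<Rightarrow> 'i free_alg \<Rightarrow> qpi) \<Rightarrow> bool" where
  "adapted_form I\<^sub>1 dot B \<longleftrightarrow>
     bilinear_over scale scale (*) B \<and>
     B 1 1 = 1 \<and>
     (\<forall>i j. B (\<theta> i) (\<theta> j) =
        of_bool (i = j) * unit_inv (1 - pi_idx I\<^sub>1 i * of_ratfun (q_idx dot i powi (-2)))) \<and>
     (\<forall>x y' y''. B x (y' * y'') = tensor_form B (coprod I\<^sub>1 dot x) (y' \<otimes> y'')) \<and>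
     (\<forall>x x' y''. B (x * x') y'' = tensor_form B (x \<otimes> x') (coprod I\<^sub>1 dot y''))"

end

theory Submission
  imports Defs
begin

text \<open>
  A form satisfying (a)--(c) can be computed from the left: peeling a letter off the first argument
  must give \<open>(\<theta>\<^sub>i x, y) = c\<^sub>i (x, \<partial>\<^sub>i y)\<close>, where \<open>c\<^sub>i = (\<theta>\<^sub>i, \<theta>\<^sub>i)\<close> and \<open>\<theta>\<^sub>i \<otimes> \<partial>\<^sub>i y\<close> is the part of
  \<open>r(y)\<close> whose first tensor factor is \<open>\<theta>\<^sub>i\<close>. The map \<open>\<partial>\<^sub>i\<close> is a skew derivation,
  \<open>\<partial>\<^sub>i(y' y'') = \<partial>\<^sub>i(y') y'' + K\<^sub>i(y') \<partial>\<^sub>i(y'')\<close>, where \<open>K\<^sub>i\<close> multiplies an element of weight \<open>\<nu>\<close> by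
  \<open>q\<^bsup>i\<cdot>\<nu>\<^esup> \<pi>\<^bsup>p(i)p(\<nu>)\<^esup>\<close>. The proof takes this recursion as the definition of the form.

  Property (b) is then an induction on \<open>x\<close>. For \<open>\<theta>\<^sub>i x\<close>, the skew Leibniz rule splits the left side into
  two terms, and \<open>r(\<theta>\<^sub>i x) = (\<theta>\<^sub>i \<otimes> 1) r(x) + (1 \<otimes> \<theta>\<^sub>i) r(x)\<close> splits the right side into two. They match
  because \<open>(1 \<otimes> \<theta>\<^sub>i)(x\<^sub>1 \<otimes> x\<^sub>2) = K\<^sub>i x\<^sub>1 \<otimes> \<theta>\<^sub>i x\<^sub>2\<close> and \<open>K\<^sub>i\<close> is self-adjoint for the form
  (lemmas \<open>pairing_char\<close> and \<open>pairing_mult_right\<close>).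

  Symmetry rests on \<open>(x, \<theta>\<^sub>j y) = c\<^sub>j (\<partial>\<^sub>j x, y)\<close>, the mirror image of the defining recursion
  (lemma \<open>pairing_theta_right\<close>). It follows by induction on \<open>x\<close> from the symmetry of the twist
  \<open>q\<^bsup>i\<cdot>j\<^esup> \<pi>\<^bsup>p(i)p(j)\<^esup>\<close> in \<open>i\<close> and \<open>j\<close>. Since the form on the tensor square carries no sign, it inherits
  symmetry, so (c) is the transpose of (b).

  For uniqueness, \<open>(1, 1) = 1\<close> and (a)--(c) fix all values \<open>(1, y)\<close> and \<open>(\<theta>\<^sub>i, y)\<close>, and (c) then reduces \<open>(\<theta>\<^sub>i x, y)\<close> to
  values with first argument \<open>\<theta>\<^sub>i\<close> or \<open>x\<close>.
\<close>

section \<open>Linear maps on the free algebra\<close>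

lemma linear_add:
  assumes "module_hom s t f" "module_hom s t g"
  shows "module_hom s t (\<lambda>x. f x + g x)"
  using assms by (auto simp: module_hom_iff module.scale_right_distrib algebra_simps)

lemma lookup_linear: "module_hom scale (*) (\<lambda>x. Poly_Mapping.lookup x a)"
  by (simp add: module_hom_iff module_scale module_mult lookup_add lookup_scale)

lemma single_Cons:
  "(Poly_Mapping.single (Word (i # is)) 1 :: 'i free_alg) = \<theta> i * Poly_Mapping.single (Word is) 1"
  by (simp add: theta_def mult_single plus_word_def)

lemma single_Nil: "(Poly_Mapping.single (Word []) 1 :: 'i free_alg) = 1"
  by (simp flip: zero_word_def)

text \<open>Induction on words for identities that are linear in \<open>x\<close>. The parameter \<open>z\<close> changes between the
  step and its induction hypothesis, which is what recursions through \<open>\<partial>\<^sub>i\<close> require.\<close>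

lemma free_alg_eqI:
  fixes g h :: "'i free_alg \<Rightarrow> 'z \<Rightarrow> 'm::ab_group_add"
  assumes g: "\<And>z. module_hom scale s (\<lambda>x. g x z)" and h: "\<And>z. module_hom scale s (\<lambda>x. h x z)"
    and one: "\<And>z. g 1 z = h 1 z"
    and theta: "\<And>i x z. (\<And>z. g x z = h x z) \<Longrightarrow> g (\<theta> i * x) z = h (\<theta> i * x) z"
  shows "g x z = h x z"
proof (rule linear_eqI[OF g h])
  fix w :: "'i word"
  have "g (Poly_Mapping.single (Word is) 1) z = h (Poly_Mapping.single (Word is) 1) z" for "is" z
    by (induction "is" arbitrary: z) (simp_all add: single_Nil single_Cons one theta)
  from this[of "letters w" z]
  show "g (Poly_Mapping.single w 1) z = h (Poly_Mapping.single w 1) z" by simp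
qed

lemmas scale_distrib = module.scale_right_distrib[OF module_scale]
  module.scale_scale[OF module_scale] scale_mult

section \<open>Characters and skew derivations\<close>

context super_cartan_datum
begin

lemma twist_commute: "twist I\<^sub>1 dot \<mu> \<nu> = twist I\<^sub>1 dot \<nu> \<mu>"
  by (simp add: twist_def dot_sym mult.commute)

definition braid :: "'i \<Rightarrow> 'i word \<Rightarrow> qpi" where
  "braid i w = twist I\<^sub>1 dot (weight (Word [i])) (weight w)"

lemma braid_zero [simp]: "braid i 0 = 1"
  by (simp add: braid_def weight_zero twist_zero)

lemma braid_add: "braid i (v + w) = braid i v * braid i w"
  by (simp add: braid_def weight_add twist_add_right)

lemma braid_commute: "braid i (Word [j]) = braid j (Word [i])"
  by (simp add: braid_def twist_commute)

text \<open>The diagonal automorphism \<open>K\<^sub>i\<close>: it records the scalar picked up when a letter \<open>i\<close> is moved past an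
  element. Being defined on all of the algebra, it replaces homogeneity assumptions.\<close>

definition char_aut :: "'i \<Rightarrow> 'i free_alg \<Rightarrow> 'i free_alg" where
  "char_aut i = lin_ext scale (\<lambda>w. scale (braid i w) (Poly_Mapping.single w 1))"

lemma char_aut_linear: "module_hom scale scale (char_aut i)"
  unfolding char_aut_def by (rule lin_ext_linear[OF module_scale])

lemma char_aut_single:
  "char_aut i (Poly_Mapping.single w 1) = scale (braid i w) (Poly_Mapping.single w 1)"
  by (simp add: char_aut_def lin_ext_single[OF module_scale] module.scale_one[OF module_scale])

lemma char_aut_one: "char_aut i 1 = 1"
  using char_aut_single[of i 0] by (simp add: module.scale_one[OF module_scale])

lemma char_aut_theta_mult:
  "char_aut i (\<theta> j * x) = scale (braid i (Word [j])) (\<theta> j * char_aut i x)"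
proof (rule linear_eqI[where g = "\<lambda>x. char_aut i (\<theta> j * x)"])
  fix w
  show "char_aut i (\<theta> j * Poly_Mapping.single w 1) =
    scale (braid i (Word [j])) (\<theta> j * char_aut i (Poly_Mapping.single w 1))"
    by (simp add: theta_def mult_single char_aut_single braid_add scale_distrib)
qed (auto intro!: linear_intros char_aut_linear module_hom_comp[OF _ char_aut_linear])

lemma char_aut_lookup_zero:
  "Poly_Mapping.lookup (char_aut i y) 0 = Poly_Mapping.lookup y 0"
  by (rule linear_eqI[OF module_hom_comp[OF char_aut_linear lookup_linear] lookup_linear])
     (simp add: char_aut_single lookup_scale lookup_single when_def)

primrec deriv_letters :: "'i \<Rightarrow> 'i list \<Rightarrow> 'i free_alg" where
  "deriv_letters i [] = 0"
| "deriv_letters i (j # js) = scale (of_bool (i = j)) (Poly_Mapping.single (Word js) 1) +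
     scale (braid i (Word [j])) (\<theta> j * deriv_letters i js)"

text \<open>The skew derivation \<open>\<partial>\<^sub>i\<close> with \<open>\<partial>\<^sub>i \<theta>\<^sub>j = \<delta>\<^sub>i\<^sub>j\<close>: it deletes one occurrence of the letter \<open>i\<close>
  after moving it to the front of the word.\<close>

definition skew_deriv :: "'i \<Rightarrow> 'i free_alg \<Rightarrow> 'i free_alg" where
  "skew_deriv i = lin_ext scale (\<lambda>w. deriv_letters i (letters w))"

lemma skew_deriv_linear: "module_hom scale scale (skew_deriv i)"
  unfolding skew_deriv_def by (rule lin_ext_linear[OF module_scale])

lemmas deriv_intros = linear_intros linear_add char_aut_linear skew_deriv_linear
  module_hom_comp[OF _ char_aut_linear] module_hom_comp[OF _ skew_deriv_linear]

lemmas deriv_hom_simps =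
  module_hom.add[OF char_aut_linear] module_hom.scale[OF char_aut_linear]
  module_hom.add[OF skew_deriv_linear] module_hom.scale[OF skew_deriv_linear]

lemma skew_deriv_single:
  "skew_deriv i (Poly_Mapping.single w 1) = deriv_letters i (letters w)"
  by (simp add: skew_deriv_def lin_ext_single[OF module_scale] module.scale_one[OF module_scale])

lemma skew_deriv_one: "skew_deriv i 1 = 0"
  using skew_deriv_single[of i 0] by (simp add: zero_word_def[symmetric] flip: single_one)
     (simp add: zero_word_def)

lemma skew_deriv_theta_mult:
  "skew_deriv i (\<theta> j * x) =
     scale (of_bool (i = j)) x + scale (braid i (Word [j])) (\<theta> j * skew_deriv i x)"
proof (rule linear_eqI[where g = "\<lambda>x. skew_deriv i (\<theta> j * x)"])
  fix w
  show "skew_deriv i (\<theta> j * Poly_Mapping.single w 1) =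
    scale (of_bool (i = j)) (Poly_Mapping.single w 1) +
    scale (braid i (Word [j])) (\<theta> j * skew_deriv i (Poly_Mapping.single w 1))"
    by (cases w) (simp add: skew_deriv_single flip: single_Cons)
qed (auto intro!: deriv_intros)

lemma skew_deriv_mult:
  "skew_deriv i (x * y) = skew_deriv i x * y + char_aut i x * skew_deriv i y"
proof (rule free_alg_eqI[where g = "\<lambda>x y. skew_deriv i (x * y)"
      and h = "\<lambda>x y. skew_deriv i x * y + char_aut i x * skew_deriv i y"])
  fix j and x z :: "'i free_alg"
  assume "\<And>z. skew_deriv i (x * z) = skew_deriv i x * z + char_aut i x * skew_deriv i z"
  thus "skew_deriv i (\<theta> j * x * z) =
      skew_deriv i (\<theta> j * x) * z + char_aut i (\<theta> j * x) * skew_deriv i z"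
    by (simp add: mult.assoc skew_deriv_theta_mult char_aut_theta_mult scale_distrib
        distrib_left distrib_right add.assoc)
qed (auto intro!: deriv_intros simp: skew_deriv_one char_aut_one)

text \<open>Both sides scale the words left after deleting a letter \<open>j\<close>; the extra factor is the character
  of the deleted letter.\<close>

lemma skew_deriv_char_aut:
  "skew_deriv j (char_aut i y) = scale (braid i (Word [j])) (char_aut i (skew_deriv j y))"
proof (rule free_alg_eqI[where g = "\<lambda>y _. skew_deriv j (char_aut i y)"
      and h = "\<lambda>y _. scale (braid i (Word [j])) (char_aut i (skew_deriv j y))"])
  fix k and x :: "'i free_alg"
  assume "\<And>_::unit. skew_deriv j (char_aut i x) =
    scale (braid i (Word [j])) (char_aut i (skew_deriv j x))"
  hence IH: "skew_deriv j (char_aut i x) =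
    scale (braid i (Word [j])) (char_aut i (skew_deriv j x))" .
  show "skew_deriv j (char_aut i (\<theta> k * x)) =
      scale (braid i (Word [j])) (char_aut i (skew_deriv j (\<theta> k * x)))"
  proof (cases "j = k")
    case True
    show ?thesis using IH unfolding True
      by (simp add: skew_deriv_theta_mult char_aut_theta_mult deriv_hom_simps scale_distrib mult_ac)
  next
    case False
    thus ?thesis
      by (simp add: skew_deriv_theta_mult char_aut_theta_mult deriv_hom_simps scale_distrib IH mult_ac)
  qed
qed (auto intro!: deriv_intros simp: skew_deriv_one char_aut_one
      module_hom.zero[OF char_aut_linear] module.scale_zero_right[OF module_scale])

section \<open>The form\<close>

definition norm_const :: "'i \<Rightarrow> qpi" where
  "norm_const i = unit_inv (1 - pi_idx I\<^sub>1 i * of_ratfun (q_idx dot i powi (-2)))"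

primrec word_pairing :: "'i list \<Rightarrow> 'i free_alg \<Rightarrow> qpi" where
  "word_pairing [] y = Poly_Mapping.lookup y 0"
| "word_pairing (i # is) y = norm_const i * word_pairing is (skew_deriv i y)"

definition pairing :: "'i free_alg \<Rightarrow> 'i free_alg \<Rightarrow> qpi" where
  "pairing x y = lin_ext (*) (\<lambda>w. word_pairing (letters w) y) x"

lemma word_pairing_linear: "module_hom scale (*) (word_pairing is)"
proof (induction "is")
  case Nil
  show ?case by (simp add: lookup_linear)
next
  case (Cons i "is")
  from module_hom_comp[OF skew_deriv_linear this]
  show ?case by (auto intro: linear_mult_qpi)
qed

lemma pairing_bilinear: "bilinear_over scale scale (*) pairing"
  unfolding bilinear_over_def pairing_def
  by (intro conjI allI lin_ext_linear lin_ext_linear_param module_mult module_scale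
      word_pairing_linear)

lemmas pairing_linear = bilinear_overD[OF pairing_bilinear]

lemmas pairing_intros = deriv_intros pairing_linear
  module_hom_comp[OF _ pairing_linear(1)] module_hom_comp[OF _ pairing_linear(2)]

lemmas pairing_hom_simps =
  module_hom.add[OF pairing_linear(1)] module_hom.scale[OF pairing_linear(1)]
  module_hom.add[OF pairing_linear(2)] module_hom.scale[OF pairing_linear(2)]

lemma pairing_single: "pairing (Poly_Mapping.single w 1) y = word_pairing (letters w) y"
  by (simp add: pairing_def lin_ext_single[OF module_mult])

lemma pairing_one_left: "pairing 1 y = Poly_Mapping.lookup y 0"
  using pairing_single[of 0 y] by (simp add: zero_word_def[symmetric] flip: single_one)
     (simp add: zero_word_def)

lemma pairing_theta_left: "pairing (\<theta> i * x) y = norm_const i * pairing x (skew_deriv i y)"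
proof (rule linear_eqI[of "(*)" "\<lambda>x. pairing (\<theta> i * x) y"])
  fix w
  show "pairing (\<theta> i * Poly_Mapping.single w 1) y =
    norm_const i * pairing (Poly_Mapping.single w 1) (skew_deriv i y)"
    by (cases w) (simp add: pairing_single flip: single_Cons)
qed (auto intro!: pairing_intros)

lemma lookup_theta_mult_zero: "Poly_Mapping.lookup (\<theta> i * y :: 'i free_alg) 0 = 0"
proof (rule linear_eqI[of "(*)" "\<lambda>y. Poly_Mapping.lookup (\<theta> i * y :: 'i free_alg) 0" "\<lambda>_. 0"])
  show "module_hom scale (*) (\<lambda>y::'i free_alg. 0::qpi)"
    by (simp add: module_hom_iff module_scale module_mult)
  show "module_hom scale (*) (\<lambda>y. Poly_Mapping.lookup (\<theta> i * y :: 'i free_alg) 0)"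
    by (intro module_hom_comp[OF _ lookup_linear] linear_intros)
qed (simp add: theta_def mult_single lookup_single plus_word_def zero_word_def)

lemma lookup_one_zero: "Poly_Mapping.lookup (1 :: 'i free_alg) 0 = 1"
  by (simp add: lookup_one)

lemma lookup_mult_zero:
  "Poly_Mapping.lookup (x * y :: 'i free_alg) 0 = Poly_Mapping.lookup x 0 * Poly_Mapping.lookup y 0"
  by (rule free_alg_eqI[where g = "\<lambda>x y. Poly_Mapping.lookup (x * y :: 'i free_alg) 0"
        and h = "\<lambda>x y. Poly_Mapping.lookup x 0 * Poly_Mapping.lookup y 0"])
     (auto intro!: lookup_linear module_hom_comp[OF _ lookup_linear] linear_intros
       simp: lookup_theta_mult_zero mult.assoc lookup_one_zero)

lemma pairing_one_right: "pairing x 1 = Poly_Mapping.lookup x 0"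
proof (rule free_alg_eqI[where g = "\<lambda>x _. pairing x 1" and h = "\<lambda>x _. Poly_Mapping.lookup x 0"])
qed (auto intro!: pairing_intros lookup_linear simp: pairing_one_left pairing_theta_left skew_deriv_one
      lookup_theta_mult_zero module_hom.zero[OF pairing_linear(2)])

text \<open>The mirror image of the defining recursion. In the step the operators \<open>\<theta>\<^sub>j\<close> and \<open>\<partial>\<^sub>i\<close> are
  interchanged on one side, \<open>\<theta>\<^sub>i\<close> and \<open>\<partial>\<^sub>j\<close> on the other; the two scalars agree because the twist of
  two letters is symmetric.\<close>

lemma pairing_theta_right: "pairing x (\<theta> j * y) = norm_const j * pairing (skew_deriv j x) y"
proof (rule free_alg_eqI[where g = "\<lambda>x y. pairing x (\<theta> j * y)"
      and h = "\<lambda>x y. norm_const j * pairing (skew_deriv j x) y"])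
  fix i and x y :: "'i free_alg"
  assume IH: "\<And>y. pairing x (\<theta> j * y) = norm_const j * pairing (skew_deriv j x) y"
  show "pairing (\<theta> i * x) (\<theta> j * y) = norm_const j * pairing (skew_deriv j (\<theta> i * x)) y"
    by (cases "i = j") (simp_all add: pairing_theta_left skew_deriv_theta_mult pairing_hom_simps IH
        braid_commute[of j i] algebra_simps)
qed (auto intro!: pairing_intros simp: pairing_one_left skew_deriv_one
      lookup_theta_mult_zero module_hom.zero[OF pairing_linear(1)])

lemma pairing_commute: "pairing x y = pairing y x"
proof (rule free_alg_eqI[where g = pairing and h = "\<lambda>x y. pairing y x"])
qed (auto intro!: pairing_intros simp: pairing_one_left pairing_one_right pairing_theta_left
      pairing_theta_right)

lemma pairing_char: "pairing (char_aut i x) y = pairing x (char_aut i y)"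
proof (rule free_alg_eqI[where g = "\<lambda>x y. pairing (char_aut i x) y"
      and h = "\<lambda>x y. pairing x (char_aut i y)"])
qed (auto intro!: pairing_intros simp: char_aut_one pairing_one_left char_aut_lookup_zero
      char_aut_theta_mult pairing_hom_simps pairing_theta_left skew_deriv_char_aut)

section \<open>Compatibility with the coproduct\<close>

lemmas tensor_form_intros = linear_intros
  bilinear_overD[OF tensor_form_bilinear]
  module_hom_comp[OF _ bilinear_overD(1)[OF tensor_form_bilinear]]
  module_hom_comp[OF _ bilinear_overD(2)[OF tensor_form_bilinear]]

text \<open>The left multiplications by \<open>\<theta>\<^sub>i \<otimes> 1\<close> and \<open>1 \<otimes> \<theta>\<^sub>i\<close> are adjoint, up to \<open>c\<^sub>i\<close>, to \<open>\<partial>\<^sub>i \<otimes> id\<close> and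
  \<open>K\<^sub>i \<otimes> \<partial>\<^sub>i\<close>, the two terms of the skew Leibniz rule.\<close>

lemma tensor_form_theta_left:
  "tensor_form pairing (tmult I\<^sub>1 dot (\<theta> i \<otimes> 1) t) (y' \<otimes> y'') =
     norm_const i * tensor_form pairing t (skew_deriv i y' \<otimes> y'')"
proof (rule linear_eqI[of "(*)" "\<lambda>t. tensor_form pairing (tmult I\<^sub>1 dot (\<theta> i \<otimes> 1) t) (y' \<otimes> y'')"])
  fix a :: "'i word \<times> 'i word"
  obtain v w where a: "a = (v, w)" by (cases a)
  let ?v = "Poly_Mapping.single v 1 :: 'i free_alg"
  let ?w = "Poly_Mapping.single w 1 :: 'i free_alg"
  have a': "Poly_Mapping.single a 1 = ?v \<otimes> ?w" by (simp add: a tensor_single)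
  have "tmult I\<^sub>1 dot (\<theta> i \<otimes> 1) (?v \<otimes> ?w) = scale 1 ((\<theta> i * ?v) \<otimes> (1 * ?w))"
    by (subst tmult_homogeneous[where \<mu> = 0 and \<nu> = "weight v"])
       (simp_all add: homogeneous_def twist_zero weight_zero)
  thus "tensor_form pairing (tmult I\<^sub>1 dot (\<theta> i \<otimes> 1) (Poly_Mapping.single a 1)) (y' \<otimes> y'') =
      norm_const i * tensor_form pairing (Poly_Mapping.single a 1) (skew_deriv i y' \<otimes> y'')"
    by (simp add: a' module.scale_one[OF module_scale] tensor_form_tensor[OF pairing_bilinear]
        pairing_theta_left)
qed (auto intro!: tensor_form_intros)

lemma tensor_form_theta_right:
  "tensor_form pairing (tmult I\<^sub>1 dot (1 \<otimes> \<theta> i) t) (y' \<otimes> y'') =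
     norm_const i * tensor_form pairing t (char_aut i y' \<otimes> skew_deriv i y'')"
proof (rule linear_eqI[of "(*)" "\<lambda>t. tensor_form pairing (tmult I\<^sub>1 dot (1 \<otimes> \<theta> i) t) (y' \<otimes> y'')"])
  fix a :: "'i word \<times> 'i word"
  obtain v w where a: "a = (v, w)" by (cases a)
  let ?v = "Poly_Mapping.single v 1 :: 'i free_alg"
  let ?w = "Poly_Mapping.single w 1 :: 'i free_alg"
  have a': "Poly_Mapping.single a 1 = ?v \<otimes> ?w" by (simp add: a tensor_single)
  have "tmult I\<^sub>1 dot (1 \<otimes> \<theta> i) (?v \<otimes> ?w) = scale (braid i v) ((1 * ?v) \<otimes> (\<theta> i * ?w))"
    unfolding braid_def by (rule tmult_homogeneous) (simp_all add: homogeneous_def theta_def)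
  also have "\<dots> = char_aut i ?v \<otimes> (\<theta> i * ?w)"
    by (simp add: char_aut_single module_hom.scale[OF bilinear_overD(1)[OF tensor_bilinear]])
  finally have "tmult I\<^sub>1 dot (1 \<otimes> \<theta> i) (?v \<otimes> ?w) = char_aut i ?v \<otimes> (\<theta> i * ?w)" .
  thus "tensor_form pairing (tmult I\<^sub>1 dot (1 \<otimes> \<theta> i) (Poly_Mapping.single a 1)) (y' \<otimes> y'') =
      norm_const i * tensor_form pairing (Poly_Mapping.single a 1) (char_aut i y' \<otimes> skew_deriv i y'')"
    by (simp add: a' tensor_form_tensor[OF pairing_bilinear] pairing_theta_left pairing_char)
qed (auto intro!: tensor_form_intros)

lemma coprod_one: "coprod I\<^sub>1 dot 1 = 1 \<otimes> 1"
  using coprod_algebra_hom by (simp add: algebra_hom_def)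

lemma coprod_theta: "coprod I\<^sub>1 dot (\<theta> i) = \<theta> i \<otimes> 1 + 1 \<otimes> \<theta> i"
  using coprod_characterization by blast

lemma coprod_mult: "coprod I\<^sub>1 dot (x * y) = tmult I\<^sub>1 dot (coprod I\<^sub>1 dot x) (coprod I\<^sub>1 dot y)"
  using coprod_algebra_hom by (simp add: algebra_hom_def)

lemma pairing_mult_right: "pairing x (y' * y'') = tensor_form pairing (coprod I\<^sub>1 dot x) (y' \<otimes> y'')"
proof -
  let ?g = "\<lambda>x z. pairing x (fst z * snd z)"
  let ?h = "\<lambda>x z. tensor_form pairing (coprod I\<^sub>1 dot x) (fst z \<otimes> snd z)"
  have "?g x (y', y'') = ?h x (y', y'')"
  proof (rule free_alg_eqI[where g = ?g and h = ?h])
    fix i and x :: "'i free_alg" and z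
    assume IH: "\<And>z. pairing x (fst z * snd z) =
      tensor_form pairing (coprod I\<^sub>1 dot x) (fst z \<otimes> snd z)"
    have IH': "pairing x (y' * y'') = tensor_form pairing (coprod I\<^sub>1 dot x) (y' \<otimes> y'')" for y' y''
      using IH[of "(y', y'')"] by simp
    show "pairing (\<theta> i * x) (fst z * snd z) =
      tensor_form pairing (coprod I\<^sub>1 dot (\<theta> i * x)) (fst z \<otimes> snd z)"
      by (simp add: coprod_mult coprod_theta pairing_theta_left skew_deriv_mult pairing_hom_simps IH'
          module_hom.add[OF bilinear_overD(1)[OF tmult_bilinear]]
          module_hom.add[OF bilinear_overD(1)[OF tensor_form_bilinear]]
          tensor_form_theta_left tensor_form_theta_right distrib_left)
  qed (auto intro!: pairing_intros tensor_form_intros coprod_linear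
        simp: coprod_one tensor_form_tensor[OF pairing_bilinear] pairing_one_left lookup_mult_zero)
  thus ?thesis by simp
qed

lemma tensor_form_commute:
  fixes B :: "'i free_alg \<Rightarrow> 'i free_alg \<Rightarrow> qpi"
  assumes "\<And>x y. B x y = B y x"
  shows "tensor_form B s t = tensor_form B t s"
proof (rule bilinear_eqI[OF tensor_form_bilinear])
  show "bilinear_over scale scale (*) (\<lambda>s t. tensor_form B t s)"
    using tensor_form_bilinear[of B] by (simp add: bilinear_over_def)
  fix a b :: "'i word \<times> 'i word"
  show "tensor_form B (Poly_Mapping.single a 1) (Poly_Mapping.single b 1) =
      tensor_form B (Poly_Mapping.single b 1) (Poly_Mapping.single a 1)"
    by (cases a; cases b)
       (simp add: tensor_form_def lin_ext_single[OF module_mult] assms)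
qed

lemma pairing_adapted: "adapted_form I\<^sub>1 dot pairing"
  unfolding adapted_form_def
proof (intro conjI allI)
  show "pairing 1 1 = 1" by (simp add: pairing_one_left lookup_one_zero)
  show "pairing (\<theta> i) (\<theta> j) =
      of_bool (i = j) * unit_inv (1 - pi_idx I\<^sub>1 i * of_ratfun (q_idx dot i powi (-2)))" for i j
    using pairing_theta_left[of i 1 "\<theta> j * 1"]
    by (simp add: skew_deriv_theta_mult[of i j 1, simplified] skew_deriv_one pairing_one_left
        norm_const_def lookup_add lookup_scale lookup_one_zero)
  show "pairing x (y' * y'') = tensor_form pairing (coprod I\<^sub>1 dot x) (y' \<otimes> y'')" for x y' y''
    by (rule pairing_mult_right)
  show "pairing (x * x') y'' = tensor_form pairing (x \<otimes> x') (coprod I\<^sub>1 dot y'')" for x x' y''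
    unfolding pairing_commute[of "x * x'"] pairing_mult_right
    by (rule tensor_form_commute[OF pairing_commute])
qed (rule pairing_bilinear)

section \<open>Uniqueness\<close>

lemma adapted_formD:
  assumes "adapted_form I\<^sub>1 dot B"
  shows "bilinear_over scale scale (*) B" "B 1 1 = 1"
    and "B (\<theta> i) (\<theta> j) = of_bool (i = j) * norm_const i"
    and "B x (y' * y'') = tensor_form B (coprod I\<^sub>1 dot x) (y' \<otimes> y'')"
    and "B (x * x') y'' = tensor_form B (x \<otimes> x') (coprod I\<^sub>1 dot y'')"
  using assms by (simp_all add: adapted_form_def norm_const_def)

text \<open>Since \<open>\<theta>\<^sub>i\<close> is primitive and \<open>1 = 1 \<cdot> 1\<close>, the values \<open>(1, \<theta>\<^sub>i)\<close> and \<open>(\<theta>\<^sub>i, 1)\<close> equal their own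
  doubles.\<close>

lemma adapted_form_one_theta:
  assumes B: "adapted_form I\<^sub>1 dot B"
  shows "B 1 (\<theta> i) = 0" "B (\<theta> i) 1 = 0"
proof -
  note T = tensor_form_tensor[OF adapted_formD(1)[OF B]] adapted_formD(2)[OF B]
    module_hom.add[OF bilinear_overD(1)[OF tensor_form_bilinear]]
    module_hom.add[OF bilinear_overD(2)[OF tensor_form_bilinear]]
  show "B 1 (\<theta> i) = 0"
    using adapted_formD(5)[OF B, of 1 1 "\<theta> i"] by (simp add: coprod_theta T)
  show "B (\<theta> i) 1 = 0"
    using adapted_formD(4)[OF B, of "\<theta> i" 1 1] by (simp add: coprod_theta T)
qed

lemma adapted_form_one_mult:
  assumes B: "adapted_form I\<^sub>1 dot B"
  shows "B 1 (\<theta> j * y) = 0"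
  by (simp add: adapted_formD(4)[OF B] coprod_one adapted_form_one_theta[OF B]
      tensor_form_tensor[OF adapted_formD(1)[OF B]])

lemma adapted_form_theta_mult:
  assumes B: "adapted_form I\<^sub>1 dot B"
  shows "B (\<theta> i) (\<theta> j * y) = of_bool (i = j) * norm_const i * B 1 y"
  by (simp add: adapted_formD(4)[OF B] coprod_theta adapted_form_one_theta[OF B]
      module_hom.add[OF bilinear_overD(1)[OF tensor_form_bilinear]]
      tensor_form_tensor[OF adapted_formD(1)[OF B]] adapted_formD(3)[OF B])

lemma adapted_form_unique:
  assumes B: "adapted_form I\<^sub>1 dot B" and C: "adapted_form I\<^sub>1 dot C"
  shows "B x y = C x y"
proof -
  note linB = bilinear_overD[OF adapted_formD(1)[OF B]]
  note linC = bilinear_overD[OF adapted_formD(1)[OF C]]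
  have one: "B 1 y = C 1 y" for y
    by (rule free_alg_eqI[where g = "\<lambda>y _::unit. B 1 y" and h = "\<lambda>y _. C 1 y"])
       (auto intro: linB linC simp: adapted_formD(2)[OF B] adapted_formD(2)[OF C]
         adapted_form_one_mult[OF B] adapted_form_one_mult[OF C])
  have theta: "B (\<theta> i) y = C (\<theta> i) y" for i y
    by (rule free_alg_eqI[where g = "\<lambda>y _::unit. B (\<theta> i) y" and h = "\<lambda>y _. C (\<theta> i) y"])
       (auto intro: linB linC simp: adapted_form_one_theta[OF B] adapted_form_one_theta[OF C]
         adapted_form_theta_mult[OF B] adapted_form_theta_mult[OF C] one)
  show ?thesis
  proof (rule free_alg_eqI[where g = B and h = C])
    fix i and x y :: "'i free_alg"
    assume IH: "\<And>y. B x y = C x y"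
    have "tensor_form B (\<theta> i \<otimes> x) t = tensor_form C (\<theta> i \<otimes> x) t" for t
    proof (rule linear_eqI[OF bilinear_overD(2)[OF tensor_form_bilinear]
          bilinear_overD(2)[OF tensor_form_bilinear]])
      fix a :: "'i word \<times> 'i word"
      have "Poly_Mapping.single a 1 =
          Poly_Mapping.single (fst a) 1 \<otimes> (Poly_Mapping.single (snd a) 1 :: 'i free_alg)"
        by (simp add: tensor_single)
      thus "tensor_form B (\<theta> i \<otimes> x) (Poly_Mapping.single a 1) =
          tensor_form C (\<theta> i \<otimes> x) (Poly_Mapping.single a 1)"
        by (simp add: tensor_form_tensor[OF adapted_formD(1)[OF B]]
            tensor_form_tensor[OF adapted_formD(1)[OF C]] theta IH)
    qed
    thus "B (\<theta> i * x) y = C (\<theta> i * x) y"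
      by (simp add: adapted_formD(5)[OF B] adapted_formD(5)[OF C])
  qed (auto intro: linB linC simp: one)
qed

end

theorem proposition1p4p1:
  fixes I\<^sub>1 :: "'i::finite set"
    and dot :: "'i root_lattice \<Rightarrow> 'i root_lattice \<Rightarrow> int"
  assumes "super_cartan_datum I\<^sub>1 dot"
  shows "(\<exists>!B. adapted_form I\<^sub>1 dot B) \<and>
    (\<forall>B. adapted_form I\<^sub>1 dot B \<longrightarrow> (\<forall>x y. B x y = B y x))"
proof -
  interpret super_cartan_datum I\<^sub>1 dot by fact
  have eq: "B = pairing" if "adapted_form I\<^sub>1 dot B" for B
    by (intro ext adapted_form_unique[OF that pairing_adapted])
  have "\<exists>!B. adapted_form I\<^sub>1 dot B"
    using pairing_adapted eq by (rule ex1I)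
  moreover have "B x y = B y x" if "adapted_form I\<^sub>1 dot B" for B x y
    unfolding eq[OF that] by (rule pairing_commute)
  ultimately show ?thesis by blast
qed

end
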